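(* Let $\alpha>0$ and let $m$ be a joining between $(X,\mathcal{A},\mu,T)$ and $(X,\mathcal{A},\alpha\mu,T)$. Then $\alpha=1$ and $m$ is a convex combination of graph measures supported by powers of $T$; that is, there exist nonnegative real numbers $(a_k)_{k\in\mathbb{Z}}$ with $\sum_{k\in\mathbb{Z}}a_k=1$ such that for all $A_1,A_2\in\mathcal{A}$, $$m(A_1\times A_2)=\sum_{k\in\mathbb{Z}}a_k\,\mu(A_1\cap T^{-k}A_2).$$
   Context: Construction of $T$ (Chacon infinite transformation). Let $X=\mathbb{R}_+=[0,\infty)$ with its Borel $\sigma$-algebra $\mathcal{A}$ and Lebesgue measure $\mu$. Tower $0$ is the single interval $[0,1)$, of height $h_0=1$. For $n\ge0$, given tower $n$, a stack of $h_n$ disjoint intervals (called levels) of length $3^{-n}$, each closed on the left and open on the right, step $n+1$ is: cut tower $n$ vertically into three subcolumns of equal width (first, second, third from left to right); put one extra interval of length $3^{-(n+1)}$ above the second (middle) subcolumn and $3h_n+1$ extra intervals of length $3^{-(n+1)}$ above the third subcolumn (extra intervals are picked successively, each time taking the leftmost interval of the desired length in the unused part of $\mathbb{R}_+$); then stack the three subcolumns, left under right, to get tower $n+1$, of height $h_{n+1}=2(3h_n+1)$. In each tower, $T$ maps each point not in the top level to the point exactly above it. This defines $T:X\to X$, which preserves $\mu$; it is injective with image $X\setminus\{0\}$, hence invertible modulo $\mu$-null sets. $T^{-k}A$ denotes the preimage of $A$ under $T^k$ for $k\ge0$, and the image $T^{|k|}A$ for $k<0$. A joining between two $\sigma$-finite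 measure preserving dynamical systems $(Y_i,\mathcal{B}_i,\nu_i,S_i)$, $i=1,2$, is any $S_1\times S_2$-invariant measure $m$ on $Y_1\times Y_2$ whose marginals are respectively $\nu_1$ and $\nu_2$. *)

theory Defs
  imports "HOL-Analysis.Analysis"
begin

text \<open>
  A tower is the list of the left end points of its levels, from bottom to top; the levels of
  tower \<open>n\<close> are the half-open intervals \<open>{a ..< a + 1 / 3 ^ n}\<close>.
\<close>

definition leftmost_free :: "real \<Rightarrow> real set \<Rightarrow> real" where
  "leftmost_free w U = (LEAST a. 0 \<le> a \<and> {a ..< a + w} \<inter> U = {})"

text \<open>Left end points of \<open>k\<close> successively picked intervals of length \<open>w\<close>, where \<open>U\<close> is
  the part of the half-line already in use.\<close>

primrec extra_intervals :: "nat \<Rightarrow> real \<Rightarrow> real set \<Rightarrow> real list" where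
  "extra_intervals 0 w U = []"
| "extra_intervals (Suc k) w U =
    (let a = leftmost_free w U in a # extra_intervals k w (U \<union> {a ..< a + w}))"

text \<open>The first extra interval picked goes above the second subcolumn, the \<open>3 * h + 1\<close>
  following ones go above the third subcolumn, from bottom to top.\<close>

primrec tower :: "nat \<Rightarrow> real list" where
  "tower 0 = [0]"
| "tower (Suc n) =
    (let L = tower n;
         w = 1 / 3 ^ Suc n;
         E = extra_intervals (1 + (3 * length L + 1)) w (\<Union>a\<in>set L. {a ..< a + 1 / 3 ^ n})
     in L @ map (\<lambda>a. a + w) L @ [hd E] @ map (\<lambda>a. a + 2 * w) L @ tl E)"

text \<open>Every point of \<open>[0, \<infinity>)\<close> lies below the top level of some tower, and the point above it does
  not depend on the tower, so the description is a proper one there. The values of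
  \<open>chacon\<close> at negative reals are irrelevant.\<close>

definition chacon :: "real \<Rightarrow> real" where
  "chacon x = (THE y. \<exists>n j. Suc j < length (tower n) \<and>
      x \<in> {tower n ! j ..< tower n ! j + 1 / 3 ^ n} \<and>
      y = tower n ! Suc j + (x - tower n ! j))"

definition mu :: "real measure" where
  "mu = restrict_space lborel {0..}"

text \<open>\<open>chacon_preimage k A\<close> is \<open>T\<^sup>-\<^sup>k A\<close>; for negative \<open>k\<close> it is the direct image
  under the \<open>\<bar>k\<bar>\<close>-th iterate.\<close>

definition chacon_preimage :: "int \<Rightarrow> real set \<Rightarrow> real set" where
  "chacon_preimage k A =
    (if 0 \<le> k then {x \<in> {0..}. (chacon ^^ nat k) x \<in> A} else (chacon ^^ nat \<bar>k\<bar>) ` A)"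

definition joining ::
  "'a measure \<Rightarrow> ('a \<Rightarrow> 'a) \<Rightarrow> 'b measure \<Rightarrow> ('b \<Rightarrow> 'b) \<Rightarrow> ('a \<times> 'b) measure \<Rightarrow> bool" where
  "joining N1 S1 N2 S2 m \<longleftrightarrow>
     sets m = sets (N1 \<Otimes>\<^sub>M N2) \<and>
     (\<forall>C \<in> sets m. emeasure m (map_prod S1 S2 -` C \<inter> space m) = emeasure m C) \<and>
     distr m N1 fst = N1 \<and>
     distr m N2 snd = N2"

end

theory Submission
  imports Defs "HOL-Library.Nat_Bijection"
begin

text \<open>
  The idea is that points in different subcolumns can be driven apart: a power of the transformation
  moves the pairs with such a mismatch, without loss of mass, to pairs with one coordinate in the spacers
  of the next tower, and over all steps only a finite mass is available there.

  Let \<open>C\<^sub>n\<close> be the part of the half-line covered by tower \<open>n\<close>, which is an initial interval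
  \<open>{0..<reach n}\<close>, and write \<open>h\<close> for the height of tower \<open>n\<close>. Suppose that \<open>x\<close> lies in
  subcolumn \<open>s\<close> and \<open>y\<close> in subcolumn \<open>t\<close> of tower \<open>n\<close>, with \<open>s < t\<close>. Move both points up along
  their orbits by the number of steps that takes subcolumn \<open>s\<close> to the third subcolumn. Then \<open>x\<close>
  arrives at the same level of tower \<open>n\<close> where it started, whereas \<open>y\<close> rises beyond the third
  subcolumn and lands among the \<open>3 * h + 1\<close> spacers above it
  (\<open>mismatch_escapes\<close>). Hence the mass of such pairs with \<open>x\<close> in a fixed \<open>C\<^sub>N\<close>, \<open>N \<le> n\<close>, is at most
  \<open>m (C\<^sub>N \<times> (C\<^bsub>n+1\<^esub> - C\<^sub>n))\<close>. These sets are disjoint for different \<open>n\<close> and lie in a set of finite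
  mass, because the marginal of \<open>m\<close> is finite on \<open>C\<^sub>N\<close>. By the Borel-Cantelli lemma almost every pair has
  only finitely many mismatches with \<open>s < t\<close>, and by symmetry only finitely many with \<open>t < s\<close>.
  Two points whose subcolumns agree from some step on have the same offset inside their levels,
  so they lie on a common orbit (\<open>eventually_matched_imp_shifted\<close>). Therefore \<open>m\<close> is
  carried by the disjoint graphs of the powers of the transformation (\<open>AE_shifted\<close>).

  On the graph of the \<open>k\<close>-th power, project \<open>m\<close> to one coordinate. By invariance the projection gives
  equal mass to all levels of a tower, and this determines it up to a factor: it is a multiple
  \<open>a k\<close> of Lebesgue measure (\<open>level_constant_measure\<close>). The two projections have the same
  factor, since the graph matches levels of a tower with levels of the same tower. Summing over \<open>k\<close>, the
  first marginal gives \<open>(\<Sum>k. a k) = 1\<close> and the second \<open>(\<Sum>k. a k) = \<alpha>\<close>.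
\<close>

section \<open>The shape of the towers\<close>

abbreviation height :: "nat \<Rightarrow> nat" where
  "height n \<equiv> length (tower n)"

text \<open>
  The levels of tower \<open>n\<close> fill the interval from \<open>0\<close> to \<open>reach n\<close>.
\<close>

definition reach :: "nat \<Rightarrow> real" where
  "reach n = real (height n) / 3 ^ n"

text \<open>
  Subcolumns are numbered \<open>0\<close>, \<open>1\<close>, \<open>2\<close>; \<open>offset n s\<close> is the height in tower \<open>Suc n\<close> at which subcolumn \<open>s\<close> of
  tower \<open>n\<close> begins. The summand \<open>1\<close> counts the spacer above subcolumn \<open>1\<close>.
\<close>

definition offset :: "nat \<Rightarrow> nat \<Rightarrow> nat" where
  "offset n s = (if s = 0 then 0 else if s = 1 then height n else 2 * height n + 1)"

lemma leftmost_free_initial: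
  assumes "0 < w" "0 < H"
  shows "leftmost_free w {0..<H} = H"
  unfolding leftmost_free_def
proof (rule Least_equality)
  show "0 \<le> H \<and> {H..<H + w} \<inter> {0..<H} = {}" using assms by auto
  fix a assume a: "0 \<le> a \<and> {a..<a + w} \<inter> {0..<H} = {}"
  then have "a \<in> {a..<a + w}" using assms by auto
  with a show "H \<le> a" by force
qed

lemma extra_intervals_initial:
  assumes "0 < w" "0 < H"
  shows "extra_intervals c w {0..<H} = map (\<lambda>i. H + real i * w) [0..<c]"
  using assms(2)
proof (induction c arbitrary: H)
  case (Suc c)
  have "{0..<H} \<union> {H..<H + w} = {0..<H + w}" using Suc.prems assms(1) by auto
  moreover have "map (\<lambda>i. H + w + real i * w) [0..<c] = map (\<lambda>i. H + real i * w) [Suc 0..<Suc c]"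
    by (simp only: map_Suc_upt[symmetric] map_map) (simp add: algebra_simps)
  ultimately show ?case
    using Suc.IH[of "H + w"] Suc.prems assms(1)
    by (simp add: leftmost_free_initial Let_def upt_conv_Cons del: upt_Suc)
qed simp

lemma length_extra_intervals [simp]: "length (extra_intervals c w U) = c"
  by (induction c arbitrary: U) (simp_all add: Let_def)

lemma height_0 [simp]: "height 0 = 1"
  by simp

lemma height_Suc: "height (Suc n) = 6 * height n + 2"
  by (simp add: Let_def del: extra_intervals.simps)

lemma height_pos: "0 < height n"
  by (induction n) (simp_all add: height_Suc del: tower.simps(2))

lemma Union_triadic:
  fixes h n :: nat
  shows "(\<Union>a\<in>(\<lambda>k. real k / 3 ^ n) ` {..<h}. {a..<a + 1 / 3 ^ n}) = {0..<real h / 3 ^ n}"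
proof (intro set_eqI iffI)
  fix x assume "x \<in> (\<Union>a\<in>(\<lambda>k. real k / 3 ^ n) ` {..<h}. {a..<a + 1 / 3 ^ n})"
  then obtain k where k: "k < h" "real k / 3 ^ n \<le> x" "x < real k / 3 ^ n + 1 / 3 ^ n" by auto
  have "real k / 3 ^ n + 1 / 3 ^ n = real (Suc k) / 3 ^ n" by (simp add: field_simps)
  also have "\<dots> \<le> real h / 3 ^ n" using k(1) by (intro divide_right_mono) auto
  finally show "x \<in> {0..<real h / 3 ^ n}"
    using k(2,3) order_trans[of 0 "real k / 3 ^ n" x] by auto
next
  fix x assume x: "x \<in> {0..<real h / 3 ^ n}"
  define k where "k = nat \<lfloor>x * 3 ^ n\<rfloor>"
  have k: "real k \<le> x * 3 ^ n" "x * 3 ^ n < real k + 1"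
    using x unfolding k_def by (auto simp: of_nat_nat)
  have "x * 3 ^ n < real h" using x by (simp add: field_simps)
  then have "k < h" using k by linarith
  moreover have "real k / 3 ^ n \<le> x" "x < real k / 3 ^ n + 1 / 3 ^ n"
    using k by (simp_all add: field_simps)
  ultimately show "x \<in> (\<Union>a\<in>(\<lambda>k. real k / 3 ^ n) ` {..<h}. {a..<a + 1 / 3 ^ n})" by force
qed

text \<open>
  The levels of tower \<open>n\<close> are consecutive triadic intervals that start at \<open>0\<close>, so every extra interval is picked
  directly to the right of the part in use. The two facts need each other: the explicit recursion holds because
  the previous tower covers an initial interval.
\<close>

lemma set_tower: "set (tower n) = (\<lambda>k. real k / 3 ^ n) ` {..<height n}"
  and tower_Suc_eq: "tower (Suc n) = tower n @ map (\<lambda>a. a + 1 / 3 ^ Suc n) (tower n) @ [reach n]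
      @ map (\<lambda>a. a + 2 / 3 ^ Suc n) (tower n)
      @ map (\<lambda>i. reach n + real i / 3 ^ Suc n) [Suc 0..<3 * height n + 2]"
proof -
  have step: "tower (Suc n) = tower n @ map (\<lambda>a. a + 1 / 3 ^ Suc n) (tower n) @ [reach n]
      @ map (\<lambda>a. a + 2 / 3 ^ Suc n) (tower n)
      @ map (\<lambda>i. reach n + real i / 3 ^ Suc n) [Suc 0..<3 * height n + 2]"
    if "set (tower n) = (\<lambda>k. real k / 3 ^ n) ` {..<height n}" for n
  proof -
    have "(\<Union>a\<in>set (tower n). {a..<a + 1 / 3 ^ n}) = {0..<reach n}"
      unfolding that reach_def by (rule Union_triadic)
    moreover have "0 < reach n" using height_pos[of n] by (simp add: reach_def)
    ultimately show ?thesis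
      by (simp add: Let_def extra_intervals_initial upt_conv_Cons map_tl[symmetric]
          del: extra_intervals.simps upt_Suc)
  qed
  show set: "set (tower n) = (\<lambda>k. real k / 3 ^ n) ` {..<height n}" for n
  proof (induction n)
    case 0
    show ?case by (auto simp: lessThan_Suc)
  next
    case (Suc n)
    let ?g = "\<lambda>k. real k / 3 ^ Suc n" and ?h = "height n"
    have sub: "(\<lambda>a. a + real s / 3 ^ Suc n) ` set (tower n) = ?g ` (\<lambda>k. 3 * k + s) ` {..<?h}" for s
      unfolding Suc.IH image_image by (intro image_cong refl) (simp add: field_simps)
    have "(\<lambda>i. reach n + real i / 3 ^ Suc n) ` A = ?g ` (\<lambda>i. 3 * ?h + i) ` A" for A
      unfolding image_image by (intro image_cong refl) (simp add: reach_def field_simps)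
    note ext = this[of "{Suc 0..<3 * ?h + 2}"]
    have reach: "reach n = ?g (3 * ?h)" by (simp add: reach_def)
    have "set (tower (Suc n)) = ?g ` ((\<lambda>k. 3 * k + 0) ` {..<?h} \<union> (\<lambda>k. 3 * k + 1) ` {..<?h}
        \<union> (\<lambda>k. 3 * k + 2) ` {..<?h} \<union> {3 * ?h} \<union> (\<lambda>i. 3 * ?h + i) ` {Suc 0..<3 * ?h + 2})"
      unfolding step[OF Suc.IH] set_append set_map set_upt list.set image_Un image_insert image_empty
        ext reach[symmetric] sub[symmetric]
      by (simp add: Un_ac del: tower.simps)
    also have "(\<lambda>k. 3 * k + 0) ` {..<?h} \<union> (\<lambda>k. 3 * k + 1) ` {..<?h}
        \<union> (\<lambda>k. 3 * k + 2) ` {..<?h} \<union> {3 * ?h} \<union> (\<lambda>i. 3 * ?h + i) ` {Suc 0..<3 * ?h + 2}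
        = {..<height (Suc n)}" (is "?A = _")
    proof
      show "?A \<subseteq> {..<height (Suc n)}" using height_pos[of n] by (auto simp: height_Suc simp del: tower.simps)
      show "{..<height (Suc n)} \<subseteq> ?A"
      proof
        fix k assume k: "k \<in> {..<height (Suc n)}"
        show "k \<in> ?A"
        proof (cases "k < 3 * ?h")
          case True
          have "k = 3 * (k div 3) + k mod 3" "k div 3 < ?h" using True by auto
          moreover have "k mod 3 = 0 \<or> k mod 3 = 1 \<or> k mod 3 = 2" by auto
          ultimately show ?thesis by (metis (no_types, lifting) UnCI image_eqI lessThan_iff)
        next
          case False
          then have "k = 3 * ?h \<or> k \<in> (\<lambda>i. 3 * ?h + i) ` {Suc 0..<3 * ?h + 2}"
            using k by (auto simp: height_Suc image_iff simp del: tower.simps intro!: bexI[of _ "k - 3 * ?h"])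
          then show ?thesis by auto
        qed
      qed
    qed
    finally show ?case .
  qed
  show "tower (Suc n) = tower n @ map (\<lambda>a. a + 1 / 3 ^ Suc n) (tower n) @ [reach n]
      @ map (\<lambda>a. a + 2 / 3 ^ Suc n) (tower n)
      @ map (\<lambda>i. reach n + real i / 3 ^ Suc n) [Suc 0..<3 * height n + 2]"
    by (rule step[OF set])
qed

declare tower.simps(2) [simp del]

lemma distinct_tower: "distinct (tower n)"
proof (rule card_distinct)
  have "inj_on (\<lambda>k. real k / 3 ^ n) {..<height n}" by (rule inj_onI) simp
  then show "card (set (tower n)) = height n" unfolding set_tower by (simp add: card_image)
qed

lemma tower_Suc_nth:
  assumes "i < height n" "s < 3"
  shows "tower (Suc n) ! (offset n s + i) = tower n ! i + real s / 3 ^ Suc n"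
proof -
  have "s = 0 \<or> s = 1 \<or> s = 2" using assms(2) by auto
  then show ?thesis using assms(1)
    by (auto simp: tower_Suc_eq nth_append offset_def)
qed

lemma offset_less: "i < height n \<Longrightarrow> offset n s + i < height (Suc n)"
  by (auto simp: height_Suc offset_def)

section \<open>Coordinates in a tower\<close>

text \<open>
  The offset \<open>r\<close> is a separate argument because the transformation preserves it: two points of tower \<open>n\<close> with the same
  offset lie on a common orbit, and the difference of their levels tells how far apart.
\<close>

definition coord :: "nat \<Rightarrow> nat \<Rightarrow> real \<Rightarrow> real \<Rightarrow> bool" where
  "coord n i r x \<longleftrightarrow> i < height n \<and> 0 \<le> r \<and> r < 1 / 3 ^ n \<and> x = tower n ! i + r"

lemma tower_nth_triadic:
  assumes "i < height n"
  obtains k where "k < height n" "tower n ! i = real k / 3 ^ n"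
  using nth_mem[OF assms] unfolding set_tower by auto

lemma coord_imp_floor:
  assumes "coord n i r x"
  shows "tower n ! i = real_of_int \<lfloor>x * 3 ^ n\<rfloor> / 3 ^ n"
proof -
  obtain k where k: "tower n ! i = real k / 3 ^ n"
    using assms tower_nth_triadic unfolding coord_def by blast
  have "x * 3 ^ n = real k + r * 3 ^ n" "0 \<le> r * 3 ^ n" "r * 3 ^ n < 1"
    using assms k unfolding coord_def by (auto simp: field_simps)
  then have "\<lfloor>x * 3 ^ n\<rfloor> = int k" by linarith
  then show ?thesis using k by simp
qed

lemma coord_unique:
  assumes "coord n i r x" "coord n j r' x"
  shows "i = j" and "r = r'"
proof -
  have eq: "tower n ! i = tower n ! j" using assms coord_imp_floor by metis
  then show "i = j" using assms distinct_tower nth_eq_iff_index_eq unfolding coord_def by blast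
  show "r = r'" using eq assms unfolding coord_def by auto
qed

lemma coord_exists_iff: "(\<exists>i r. coord n i r x) \<longleftrightarrow> 0 \<le> x \<and> x < reach n"
proof -
  have "0 \<le> x \<and> x < reach n \<longleftrightarrow> x \<in> (\<Union>a\<in>set (tower n). {a..<a + 1 / 3 ^ n})"
    unfolding set_tower Union_triadic reach_def by simp
  also have "\<dots> \<longleftrightarrow> (\<exists>i<height n. tower n ! i \<le> x \<and> x < tower n ! i + 1 / 3 ^ n)"
    by (force simp: in_set_conv_nth)
  also have "\<dots> \<longleftrightarrow> (\<exists>i r. coord n i r x)"
  proof
    assume "\<exists>i<height n. tower n ! i \<le> x \<and> x < tower n ! i + 1 / 3 ^ n"
    then obtain i where "i < height n" "tower n ! i \<le> x" "x < tower n ! i + 1 / 3 ^ n" by auto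
    then have "coord n i (x - tower n ! i) x" by (auto simp: coord_def)
    then show "\<exists>i r. coord n i r x" by blast
  qed (auto simp: coord_def)
  finally show ?thesis by simp
qed

text \<open>
  The point \<open>x\<close> only serves to give \<open>r\<close> its range: the subcolumn \<open>s\<close> is a function of the offset \<open>r\<close>
  alone, so all points with the same offset go to the same subcolumn. This is what makes differences of
  positions stable under refinement.
\<close>

lemma coord_Suc:
  assumes "coord n i r x"
  obtains s where "s < 3" "real s / 3 ^ Suc n \<le> r" "r < real (Suc s) / 3 ^ Suc n"
    "\<And>j y. coord n j r y \<Longrightarrow> coord (Suc n) (offset n s + j) (r - real s / 3 ^ Suc n) y"
proof -
  define s where "s = nat \<lfloor>r * 3 ^ Suc n\<rfloor>"
  have r: "0 \<le> r" "r < 1 / 3 ^ n" using assms by (auto simp: coord_def)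
  have "real s = real_of_int \<lfloor>r * 3 ^ Suc n\<rfloor>" using r(1) by (simp add: s_def of_nat_nat)
  then have s: "real s \<le> r * 3 ^ Suc n" "r * 3 ^ Suc n < real (Suc s)"
    unfolding of_nat_Suc by linarith+
  have "r * 3 ^ Suc n < 3" using r by (simp add: field_simps)
  then have s3: "s < 3" using s by linarith
  have le: "real s / 3 ^ Suc n \<le> r" "r < real (Suc s) / 3 ^ Suc n"
    using s by (simp_all add: field_simps)
  moreover have "coord (Suc n) (offset n s + j) (r - real s / 3 ^ Suc n) y" if "coord n j r y" for j y
  proof -
    have "real (Suc s) / 3 ^ Suc n = 1 / 3 ^ Suc n + real s / 3 ^ Suc n"
      by (simp add: add_divide_distrib)
    then show ?thesis using that s3 le offset_less[of j n s]
      by (simp add: coord_def tower_Suc_nth del: power_Suc)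
  qed
  ultimately show ?thesis using s3 that by blast
qed

text \<open>
  Passing to a later tower adds one and the same constant to the positions of all points that share an
  offset.
\<close>

lemma coord_refine:
  assumes "coord n i r x" "n \<le> m"
  obtains c r' where "\<And>j y. coord n j r y \<Longrightarrow> coord m (c + j) r' y"
proof -
  have "\<exists>c r'. \<forall>j y. coord n j r y \<longrightarrow> coord m (c + j) r' y"
    using assms(2)
  proof (induction m rule: dec_induct)
    case base
    show ?case by (intro exI[of _ 0] exI[of _ r]) simp
  next
    case (step m)
    then obtain c r' where c: "\<forall>j y. coord n j r y \<longrightarrow> coord m (c + j) r' y" by blast
    with assms(1) have "coord m (c + i) r' x" by blast
    from coord_Suc[OF this] obtain s where
      "\<And>j y. coord m j r' y \<Longrightarrow> coord (Suc m) (offset m s + j) (r' - real s / 3 ^ Suc m) y" by metis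
    with c show ?case
      by (intro exI[of _ "offset m s + c"] exI[of _ "r' - real s / 3 ^ Suc m"]) (simp add: add.assoc)
  qed
  then show ?thesis using that by blast
qed

lemma power2_le_reach: "2 ^ n \<le> reach n"
proof (induction n)
  case (Suc n)
  have "2 * reach n \<le> reach (Suc n)" by (simp add: reach_def height_Suc field_simps)
  with Suc show ?case by simp
qed (simp add: reach_def)

lemma less_reach: obtains n where "x < reach n"
proof -
  obtain n where "x < 2 ^ n" using real_arch_pow[of 2 x] by auto
  then show ?thesis using power2_le_reach[of n] that[of n] by simp
qed

lemma reach_mono: "n \<le> m \<Longrightarrow> reach n \<le> reach m"
proof (induction m rule: dec_induct)
  case (step m)
  have "reach m \<le> reach (Suc m)" by (simp add: reach_def height_Suc field_simps)
  with step show ?case by simp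
qed simp

lemma coord_exists:
  assumes "0 \<le> x" obtains n i r where "coord n i r x"
  using assms coord_exists_iff less_reach by metis

lemma coord_exists_ge:
  assumes "0 \<le> x" obtains n i r where "m \<le> n" "coord n i r x"
proof -
  obtain n where "x < reach n" by (rule less_reach)
  then have "x < reach (max m n)" using reach_mono[of n "max m n"] by simp
  with assms show ?thesis using coord_exists_iff that by (metis max.cobounded1)
qed

lemma coord_nonneg: "coord n i r x \<Longrightarrow> 0 \<le> x"
  using coord_exists_iff by blast

section \<open>Positions on a common orbit\<close>

text \<open>
  Points of the graph of the \<open>k\<close>-th power, for positive and negative \<open>k\<close> alike: in some tower, \<open>y\<close> is \<open>k\<close> levels
  above \<open>x\<close>, at the same offset. All properties of the powers are read off from common towers.
\<close>

definition shifted :: "int \<Rightarrow> real \<Rightarrow> real \<Rightarrow> bool" where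
  "shifted k x y \<longleftrightarrow> (\<exists>n i j r. coord n i r x \<and> coord n j r y \<and> int j = int i + k)"

lemma shifted_nonneg: assumes "shifted k x y" shows "0 \<le> x" "0 \<le> y"
  using assms coord_nonneg unfolding shifted_def by blast+

lemma shifted_minus: "shifted k x y \<Longrightarrow> shifted (- k) y x"
  unfolding shifted_def by (metis add.commute minus_add_cancel)

lemma shifted_sym: "shifted k x y \<longleftrightarrow> shifted (- k) y x"
  using shifted_minus[of k x y] shifted_minus[of "- k" y x] by auto

lemma shifted_at:
  assumes "shifted k x y"
  obtains n0 where "\<And>n. n0 \<le> n \<Longrightarrow> \<exists>i j r. coord n i r x \<and> coord n j r y \<and> int j = int i + k"
proof -
  obtain n0 i j r where c: "coord n0 i r x" "coord n0 j r y" "int j = int i + k"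
    using assms unfolding shifted_def by blast
  have "\<exists>i j r. coord n i r x \<and> coord n j r y \<and> int j = int i + k" if n: "n0 \<le> n" for n
  proof -
    obtain d r' where "\<And>j y. coord n0 j r y \<Longrightarrow> coord n (d + j) r' y"
      using coord_refine[OF c(1) n] by metis
    then have "coord n (d + i) r' x" "coord n (d + j) r' y" using c by auto
    moreover have "int (d + j) = int (d + i) + k" using c(3) by simp
    ultimately show ?thesis by blast
  qed
  then show ?thesis using that by blast
qed

lemma shifted_trans:
  assumes "shifted k x y" "shifted l y z"
  shows "shifted (k + l) x z"
proof -
  obtain n1 where 1: "\<And>n. n1 \<le> n \<Longrightarrow> \<exists>i j r. coord n i r x \<and> coord n j r y \<and> int j = int i + k"
    using shifted_at[OF assms(1)] by blast
  obtain n2 where 2: "\<And>n. n2 \<le> n \<Longrightarrow> \<exists>i j r. coord n i r y \<and> coord n j r z \<and> int j = int i + l"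
    using shifted_at[OF assms(2)] by blast
  define n where "n = max n1 n2"
  obtain i j r where a: "coord n i r x" "coord n j r y" "int j = int i + k" using 1[of n] n_def by auto
  obtain i' j' r' where b: "coord n i' r' y" "coord n j' r' z" "int j' = int i' + l" using 2[of n] n_def by auto
  have "i' = j" "r' = r" using coord_unique[OF b(1) a(2)] by auto
  with a b show ?thesis unfolding shifted_def
    by (intro exI[of _ n] exI[of _ i] exI[of _ j'] exI[of _ r]) auto
qed

lemma shifted_refl_iff:
  assumes "shifted k x x" shows "k = 0"
proof -
  obtain n i j r where "coord n i r x" "coord n j r x" "int j = int i + k"
    using assms unfolding shifted_def by blast
  then show ?thesis using coord_unique(1)[of n i r x j r] by simp
qed

lemma shifted_0: "shifted 0 x y \<longleftrightarrow> 0 \<le> x \<and> x = y"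
proof
  assume "shifted 0 x y"
  moreover from this have "x = y" unfolding shifted_def coord_def by auto
  ultimately show "0 \<le> x \<and> x = y" using shifted_nonneg by auto
next
  assume "0 \<le> x \<and> x = y"
  moreover obtain n i r where "coord n i r x" using coord_exists calculation by blast
  ultimately show "shifted 0 x y" unfolding shifted_def by force
qed

lemma shifted_target_unique:
  assumes "shifted k x y" "shifted k x y'" shows "y = y'"
  using shifted_trans[of "- k" y x k y'] assms by (simp add: shifted_sym[symmetric] shifted_0)

lemma shifted_index_unique:
  assumes "shifted k x y" "shifted l x y" shows "k = l"
  using shifted_refl_iff[of "k - l" x] shifted_trans[of k x y "- l" x] assms by (simp add: shifted_sym[symmetric])

lemma shifted_exists:
  assumes "0 \<le> x" "0 \<le> k"
  obtains y where "shifted k x y"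
proof -
  obtain n i r where c: "nat k \<le> n" "coord n i r x" using coord_exists_ge[OF assms(1)] by metis
  from coord_Suc[OF c(2)] obtain s where s:
    "coord (Suc n) (offset n s + i) (r - real s / 3 ^ Suc n) x" using c(2) by metis
  \<comment> \<open>The point is in one of the subcolumns, and the spacers on top leave room for \<open>k \<le> n\<close> more steps.\<close>
  have "n < height n" for n by (induction n) (simp_all add: height_Suc)
  from this[of n] have "offset n s + i + nat k < height (Suc n)"
    using c by (auto simp: offset_def height_Suc coord_def)
  with s have "coord (Suc n) (offset n s + i + nat k) (r - real s / 3 ^ Suc n)
      (tower (Suc n) ! (offset n s + i + nat k) + (r - real s / 3 ^ Suc n))"
    by (auto simp: coord_def)
  with s show ?thesis using assms(2) that unfolding shifted_def
    by (metis int_nat_eq of_nat_add)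
qed

lemma shifted_coord:
  assumes "shifted k x y" "coord n i r x" "int j = int i + k" "j < height n"
  shows "coord n j r y"
proof -
  have "coord n j r (tower n ! j + r)" using assms by (auto simp: coord_def)
  then have "shifted k x (tower n ! j + r)" unfolding shifted_def using assms by blast
  with assms(1) shifted_target_unique have "y = tower n ! j + r" by blast
  with \<open>coord n j r (tower n ! j + r)\<close> show ?thesis by simp
qed

lemma shifted_chacon:
  assumes "0 \<le> x" shows "shifted 1 x (chacon x)"
proof -
  have eq: "(\<exists>n j. Suc j < length (tower n) \<and> x \<in> {tower n ! j ..< tower n ! j + 1 / 3 ^ n} \<and>
      y = tower n ! Suc j + (x - tower n ! j)) \<longleftrightarrow> shifted 1 x y" for y
  proof
    assume "\<exists>n j. Suc j < length (tower n) \<and> x \<in> {tower n ! j ..< tower n ! j + 1 / 3 ^ n} \<and>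
      y = tower n ! Suc j + (x - tower n ! j)"
    then obtain n j where "Suc j < length (tower n)" "x \<in> {tower n ! j ..< tower n ! j + 1 / 3 ^ n}"
      "y = tower n ! Suc j + (x - tower n ! j)" by blast
    then have "coord n j (x - tower n ! j) x" "coord n (Suc j) (x - tower n ! j) y" by (auto simp: coord_def)
    then show "shifted 1 x y" unfolding shifted_def by (metis of_nat_Suc add.commute)
  next
    assume "shifted 1 x y"
    then obtain n i j r where c: "coord n i r x" "coord n j r y" "int j = int i + 1" unfolding shifted_def by blast
    then have "j = Suc i" by simp
    with c show "\<exists>n j. Suc j < length (tower n) \<and> x \<in> {tower n ! j ..< tower n ! j + 1 / 3 ^ n} \<and>
      y = tower n ! Suc j + (x - tower n ! j)" by (intro exI[of _ n] exI[of _ i]) (auto simp: coord_def)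
  qed
  obtain y where y: "shifted 1 x y" using shifted_exists[OF assms] by (metis zero_le_one)
  have "chacon x = y" unfolding chacon_def eq using y shifted_target_unique by blast
  with y show ?thesis by simp
qed

lemma chacon_nonneg: "0 \<le> x \<Longrightarrow> 0 \<le> chacon x"
  using shifted_chacon shifted_nonneg by blast

lemma shifted_chacon_funpow: "0 \<le> x \<Longrightarrow> shifted (int k) x ((chacon ^^ k) x)"
proof (induction k)
  case (Suc k)
  then have "shifted (int k + 1) x ((chacon ^^ Suc k) x)"
    using shifted_trans shifted_chacon shifted_nonneg by simp
  then show ?case by (simp add: add.commute)
qed (simp add: shifted_0)

lemma chacon_preimage_eq:
  assumes "A \<subseteq> {0..}"
  shows "chacon_preimage k A = {x. \<exists>y\<in>A. shifted k x y}"
proof (cases "0 \<le> k")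
  case True
  then have k: "int (nat k) = k" by simp
  have "(chacon ^^ nat k) x \<in> A \<longleftrightarrow> (\<exists>y\<in>A. shifted k x y)" if "0 \<le> x" for x
    using shifted_chacon_funpow[OF that, of "nat k"] shifted_target_unique unfolding k by metis
  then show ?thesis using True shifted_nonneg unfolding chacon_preimage_def by auto
next
  case False
  then have k: "int (nat \<bar>k\<bar>) = - k" by simp
  have "shifted k x y \<longleftrightarrow> x = (chacon ^^ nat \<bar>k\<bar>) y" if "y \<in> A" for x y
  proof -
    have "0 \<le> y" using that assms by auto
    from shifted_chacon_funpow[OF this, of "nat \<bar>k\<bar>"] have "shifted (- k) y ((chacon ^^ nat \<bar>k\<bar>) y)"
      unfolding k .
    then show ?thesis using shifted_sym[of k] shifted_target_unique by metis
  qed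
  then show ?thesis using False unfolding chacon_preimage_def by auto
qed

section \<open>Levels and measurability\<close>

definition level :: "nat \<Rightarrow> nat \<Rightarrow> real set" where
  "level n i = {tower n ! i..<tower n ! i + 1 / 3 ^ n}"

lemma mem_level_iff: "i < height n \<Longrightarrow> x \<in> level n i \<longleftrightarrow> (\<exists>r. coord n i r x)"
proof
  assume "i < height n" "x \<in> level n i"
  then have "coord n i (x - tower n ! i) x" by (auto simp: coord_def level_def)
  then show "\<exists>r. coord n i r x" ..
qed (auto simp: coord_def level_def)

lemma space_mu [simp]: "space mu = {0..}"
  by (simp add: mu_def space_restrict_space)

lemma sets_mu_iff: "A \<in> sets mu \<longleftrightarrow> A \<in> sets borel \<and> A \<subseteq> {0..}"
  by (auto simp: mu_def sets_restrict_space_iff)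

lemma emeasure_mu: "A \<subseteq> {0..} \<Longrightarrow> emeasure mu A = emeasure lborel A"
  by (simp add: mu_def emeasure_restrict_space)

lemma level_sets_mu: "i < height n \<Longrightarrow> level n i \<in> sets mu"
  using mem_level_iff coord_nonneg by (auto simp: sets_mu_iff) (simp add: level_def)

lemma emeasure_mu_initial: "0 \<le> c \<Longrightarrow> emeasure mu {0..<c} = ennreal c"
  by (subst emeasure_mu) auto

lemma chacon_preimage_nonneg: "A \<subseteq> {0..} \<Longrightarrow> chacon_preimage k A \<subseteq> {0..}"
  using shifted_nonneg by (auto simp: chacon_preimage_eq)

lemma chacon_preimage_sets_mu:
  assumes "A \<in> sets mu"
  shows "chacon_preimage k A \<in> sets mu"
proof -
  have [measurable]: "A \<in> sets borel" and A: "A \<subseteq> {0..}" using assms by (auto simp: sets_mu_iff)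
  let ?B = "\<lambda>n i j. {x \<in> level n i. tower n ! j + (x - tower n ! i) \<in> A}"
  have "chacon_preimage k A = (\<Union>n. \<Union>i\<in>{..<height n}. \<Union>j\<in>{j. j < height n \<and> int j = int i + k}. ?B n i j)"
    (is "_ = ?U")
  proof (intro set_eqI iffI)
    fix x assume "x \<in> chacon_preimage k A"
    then obtain y where "y \<in> A" "shifted k x y" using A by (auto simp: chacon_preimage_eq)
    then obtain n i j r where c: "coord n i r x" "coord n j r y" "int j = int i + k" "y \<in> A"
      unfolding shifted_def by blast
    then have "x \<in> ?B n i j" "i < height n" "j < height n" by (auto simp: coord_def level_def)
    with c(3) show "x \<in> ?U" by blast
  next
    fix x assume "x \<in> ?U"
    then obtain n i j where c: "i < height n" "j < height n" "int j = int i + k" "x \<in> ?B n i j" by blast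
    let ?y = "tower n ! j + (x - tower n ! i)"
    have "coord n i (x - tower n ! i) x" "coord n j (x - tower n ! i) ?y"
      using c by (auto simp: coord_def level_def)
    then have "shifted k x ?y" using c(3) unfolding shifted_def by blast
    with c(4) show "x \<in> chacon_preimage k A"
      using A by (auto simp: chacon_preimage_eq)
  qed
  moreover have "?U \<in> sets borel" unfolding level_def by measurable
  ultimately have "chacon_preimage k A \<in> sets borel" by simp
  then show ?thesis using chacon_preimage_nonneg[OF A] by (simp add: sets_mu_iff)
qed

lemma chacon_funpow_nonneg: "0 \<le> x \<Longrightarrow> 0 \<le> (chacon ^^ k) x"
  using shifted_chacon_funpow shifted_nonneg by blast

lemma measurable_chacon_funpow: "chacon ^^ k \<in> measurable mu mu"
proof (rule measurableI)
  fix x assume "x \<in> space mu" then show "(chacon ^^ k) x \<in> space mu" by (simp add: chacon_funpow_nonneg)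
next
  fix A assume A: "A \<in> sets mu"
  have "(chacon ^^ k) -` A \<inter> space mu = chacon_preimage (int k) A"
    by (auto simp: chacon_preimage_def)
  then show "(chacon ^^ k) -` A \<inter> space mu \<in> sets mu" using chacon_preimage_sets_mu[OF A] by simp
qed

section \<open>Pairs in different subcolumns\<close>

definition subcolumn :: "nat \<Rightarrow> nat \<Rightarrow> real set" where
  "subcolumn n s = (\<Union>i<height n. level (Suc n) (offset n s + i))"

lemma subcolumn_sets [measurable]: "subcolumn n s \<in> sets borel"
  unfolding subcolumn_def level_def by measurable

lemma mem_subcolumnE:
  assumes "x \<in> subcolumn n s"
  obtains i r where "i < height n" "coord (Suc n) (offset n s + i) r x"
  using assms offset_less unfolding subcolumn_def by (auto simp: mem_level_iff)

lemma mem_subcolumnI: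
  "i < height n \<Longrightarrow> coord (Suc n) (offset n s + i) r x \<Longrightarrow> x \<in> subcolumn n s"
  unfolding subcolumn_def using offset_less by (auto simp: mem_level_iff)

lemma coord_coarsen:
  assumes "i < height n" "s < 3" "coord (Suc n) (offset n s + i) r x"
  shows "coord n i (r + real s / 3 ^ Suc n) x"
proof -
  have "r + real s / 3 ^ Suc n < 1 / 3 ^ Suc n + 2 / 3 ^ Suc n"
    using assms(2,3) by (intro add_less_le_mono divide_right_mono) (auto simp: coord_def)
  also have "\<dots> = 1 / 3 ^ n" by (simp add: field_simps)
  finally show ?thesis using assms by (simp add: coord_def tower_Suc_nth)
qed

lemma coord_below_reach:
  assumes "coord n i r x" "coord n i r' y" "N \<le> n" "x < reach N"
  shows "y < reach N"
proof -
  obtain q where q: "tower n ! i = real q / 3 ^ n"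
    using assms(1) tower_nth_triadic unfolding coord_def by blast
  define p where "p = height N * 3 ^ (n - N)"
  have "(3::real) ^ n = 3 ^ N * 3 ^ (n - N)" using assms(3) by (simp add: power_add[symmetric])
  then have p: "reach N = real p / 3 ^ n" by (simp add: reach_def p_def)
  have "real q / 3 ^ n < real p / 3 ^ n" using assms(1,4) q p by (auto simp: coord_def)
  then have "real (Suc q) / 3 ^ n \<le> real p / 3 ^ n"
    by (intro divide_right_mono) (auto simp: divide_less_cancel)
  moreover have "y < real (Suc q) / 3 ^ n" using assms(2) q by (auto simp: coord_def add_divide_distrib)
  ultimately show ?thesis using p by simp
qed

text \<open>
  The heart of the proof. A point at height \<open>j\<close> of subcolumn \<open>t\<close> is at least \<open>height n\<close> above its
  counterpart in subcolumn \<open>s\<close>, so when the latter reaches the third subcolumn the former is already above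
  the top of it. The \<open>3 * height n + 1\<close> spacers are enough to keep it inside tower \<open>Suc n\<close>.
\<close>

lemma mismatch_escapes:
  assumes "s < t" "t < 3" "x \<in> subcolumn n s" "y \<in> subcolumn n t" "N \<le> n" "x < reach N"
  defines "k \<equiv> offset n 2 - offset n s"
  shows "(chacon ^^ k) x < reach N"
    and "reach n \<le> (chacon ^^ k) y" and "(chacon ^^ k) y < reach (Suc n)"
proof -
  obtain i r where x: "i < height n" "coord (Suc n) (offset n s + i) r x"
    using assms(3) by (rule mem_subcolumnE)
  obtain j r' where y: "j < height n" "coord (Suc n) (offset n t + j) r' y"
    using assms(4) by (rule mem_subcolumnE)
  have st: "s = 0 \<and> t = 1 \<or> s = 0 \<and> t = 2 \<or> s = 1 \<and> t = 2" using assms(1,2) by auto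
  have k: "offset n s + k = offset n 2" using st by (auto simp: k_def offset_def)
  have "int (offset n 2 + i) = int (offset n s + i) + int k" using k by simp
  from shifted_coord[OF shifted_chacon_funpow[OF coord_nonneg[OF x(2)]] x(2) this offset_less[OF x(1)]]
  have "coord (Suc n) (offset n 2 + i) r ((chacon ^^ k) x)" .
  from coord_below_reach[OF coord_coarsen[OF x(1) _ x(2)] coord_coarsen[OF x(1) _ this] assms(5,6)]
  show "(chacon ^^ k) x < reach N" using assms(1,2) by simp
  have "offset n t + j + k < height (Suc n)"
    using st y(1) by (auto simp: k_def offset_def height_Suc)
  from shifted_coord[OF shifted_chacon_funpow[OF coord_nonneg[OF y(2)]] y(2) _ this]
  have y': "coord (Suc n) (offset n t + j + k) r' ((chacon ^^ k) y)" by simp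
  then show "(chacon ^^ k) y < reach (Suc n)" using coord_exists_iff by blast
  show "reach n \<le> (chacon ^^ k) y"
  proof (rule ccontr)
    assume "\<not> ?thesis"
    then obtain q v where q: "coord n q v ((chacon ^^ k) y)"
      using coord_exists_iff[of n] coord_nonneg[OF y'] by force
    obtain u where "coord (Suc n) (offset n u + q) (v - real u / 3 ^ Suc n) ((chacon ^^ k) y)"
      using coord_Suc[OF q] q by metis
    \<comment> \<open>All three subcolumns stay at heights up to \<open>3 * height n\<close>, and the left side is greater.\<close>
    with y' have "offset n t + j + k = offset n u + q" by (rule coord_unique)
    moreover have "q < height n" using q by (simp add: coord_def)
    ultimately show False using st by (auto simp: k_def offset_def split: if_splits)
  qed
qed

text \<open>
  As long as the subcolumns agree, refining the tower changes the offsets of \<open>x\<close> and \<open>y\<close> by the same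
  amount. Their difference is thus constant, and it is below \<open>1 / 3 ^ n\<close> for all large \<open>n\<close>.
\<close>

lemma eventually_matched_imp_shifted:
  assumes "0 \<le> x" "0 \<le> y"
    and "eventually (\<lambda>n. \<forall>s<3. \<forall>t<3. x \<in> subcolumn n s \<longrightarrow> y \<in> subcolumn n t \<longrightarrow> s = t) sequentially"
  shows "\<exists>k. shifted k x y"
proof -
  obtain n0 where n0: "\<And>n s t. n0 \<le> n \<Longrightarrow> s < 3 \<Longrightarrow> t < 3 \<Longrightarrow> x \<in> subcolumn n s \<Longrightarrow> y \<in> subcolumn n t \<Longrightarrow> s = t"
    using assms(3) unfolding eventually_sequentially by blast
  obtain l where l: "max x y < reach l" by (rule less_reach)
  define M where "M = max n0 l"
  have "max x y < reach M" using l reach_mono[of l M] by (simp add: M_def)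
  then obtain i0 r j0 r' where M: "coord M i0 r x" "coord M j0 r' y"
    using assms(1,2) coord_exists_iff by (metis max_less_iff_conj)
  have "\<exists>i j u. coord n i u x \<and> coord n j (u + (r' - r)) y" if "M \<le> n" for n
    using that
  proof (induction n rule: dec_induct)
    case base
    show ?case using M by (intro exI[of _ i0] exI[of _ j0] exI[of _ r]) simp
  next
    case (step n)
    then obtain i j u where c: "coord n i u x" "coord n j (u + (r' - r)) y" by blast
    obtain s where s: "s < 3" "coord (Suc n) (offset n s + i) (u - real s / 3 ^ Suc n) x"
      using coord_Suc[OF c(1)] c(1) by metis
    obtain t where t: "t < 3" "coord (Suc n) (offset n t + j) (u + (r' - r) - real t / 3 ^ Suc n) y"
      using coord_Suc[OF c(2)] c(2) by metis
    have "i < height n" "j < height n" using c by (auto simp: coord_def)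
    then have "s = t" using n0[of n s t] mem_subcolumnI s t step.hyps by (simp add: M_def)
    with s t show ?case
      by (intro exI[of _ "offset n s + i"] exI[of _ "offset n t + j"] exI[of _ "u - real s / 3 ^ Suc n"])
        (simp add: algebra_simps)
  qed
  then have small: "\<bar>r' - r\<bar> < 1 / 3 ^ n" if "M \<le> n" for n
    using that by (force simp: coord_def)
  have "r = r'"
  proof (rule ccontr)
    assume "r \<noteq> r'"
    then obtain n where n: "(1 / 3) ^ n < \<bar>r' - r\<bar>" using real_arch_pow_inv[of "\<bar>r' - r\<bar>" "1/3"] by auto
    have "(1 / 3::real) ^ max M n \<le> (1 / 3) ^ n" by (rule power_decreasing) auto
    with small[of "max M n"] n show False by (simp add: power_one_over)
  qed
  with M have "shifted (int j0 - int i0) x y" unfolding shifted_def by force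
  then show ?thesis ..
qed

lemma emeasure_mu_level: "i < height n \<Longrightarrow> emeasure mu (level n i) = ennreal (1 / 3 ^ n)"
  using level_sets_mu[of i n] by (simp add: sets_mu_iff emeasure_mu) (simp add: level_def)

section \<open>Measures that do not distinguish levels\<close>

lemma emeasure_initial_interval:
  fixes \<nu> :: "real measure"
  assumes sets: "sets \<nu> = sets borel"
    and const: "\<And>i. i < height n \<Longrightarrow> emeasure \<nu> (level n i) = c"
    and "k \<le> height n"
  shows "emeasure \<nu> {0..<real k / 3 ^ n} = of_nat k * c"
  using assms(3)
proof (induction k)
  case (Suc k)
  have "real k / 3 ^ n \<in> set (tower n)" using Suc.prems by (auto simp: set_tower)
  then obtain i where i: "i < height n" "tower n ! i = real k / 3 ^ n" by (auto simp: in_set_conv_nth)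
  have "{0..<real (Suc k) / 3 ^ n} = {0..<real k / 3 ^ n} \<union> level n i"
    unfolding level_def i(2) by (subst ivl_disj_un_two(3)) (auto simp: add_divide_distrib add.commute)
  also have "emeasure \<nu> \<dots> = emeasure \<nu> {0..<real k / 3 ^ n} + emeasure \<nu> (level n i)"
    by (rule plus_emeasure[symmetric]) (auto simp: level_def i(2) sets)
  also have "\<dots> = of_nat (Suc k) * c" using Suc i const by (simp add: algebra_simps)
  finally show ?case .
qed simp

lemma power_le_height: "3 ^ n \<le> height n"
  by (induction n) (simp_all add: height_Suc)

text \<open>
  Tower \<open>n\<close> contains \<open>{0..<1}\<close> as a union of \<open>3 ^ n\<close> levels, so each of its levels has a \<open>3 ^ n\<close>-th of the
  mass of \<open>{0..<1}\<close>. This determines \<open>\<nu>\<close> on all triadic initial intervals, hence on all Borel sets.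
\<close>

lemma level_constant_measure:
  fixes \<nu> :: "real measure"
  assumes sets: "sets \<nu> = sets borel" and neg: "emeasure \<nu> {..<0} = 0"
    and const: "\<And>n i. i < height n \<Longrightarrow> emeasure \<nu> (level n i) = emeasure \<nu> (level n 0)"
    and fin: "emeasure \<nu> {0..<1} < \<infinity>" and A: "A \<in> sets mu"
  shows "emeasure \<nu> A = emeasure \<nu> {0..<1} * emeasure mu A"
proof -
  obtain w where w: "0 \<le> w" "emeasure \<nu> {0..<1} = ennreal w"
    using fin by (cases "emeasure \<nu> {0..<1}") auto
  have lev: "emeasure \<nu> (level n i) = ennreal (w / 3 ^ n)" if "i < height n" for n i
  proof -
    have "ennreal w = of_nat (3 ^ n) * emeasure \<nu> (level n 0)"
      using emeasure_initial_interval[OF sets const power_le_height, of n] w by simp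
    also have "of_nat (3 ^ n) = ennreal (3 ^ n)" by (simp add: ennreal_power[symmetric])
    finally have *: "ennreal w = ennreal (3 ^ n) * emeasure \<nu> (level n 0)" .
    have "ennreal (w / 3 ^ n) = ennreal (1 / 3 ^ n) * ennreal w"
      using w(1) by (simp add: ennreal_mult'[symmetric])
    also have "\<dots> = emeasure \<nu> (level n 0)"
      unfolding * mult.assoc[symmetric] by (simp add: ennreal_mult'[symmetric])
    finally show ?thesis using const[OF that] by simp
  qed
  have init: "emeasure \<nu> {0..<real k / 3 ^ n} = ennreal (w * (real k / 3 ^ n))" for k n
  proof -
    obtain l where "real k / 3 ^ n < reach l" by (rule less_reach)
    define m where "m = max l n"
    have m: "real k / 3 ^ n < reach m" "n \<le> m"
      using \<open>_ < reach l\<close> reach_mono[of l m] by (auto simp: m_def)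
    define k' where "k' = k * 3 ^ (m - n)"
    have "(3::real) ^ m = 3 ^ n * 3 ^ (m - n)" using m(2) by (simp add: power_add[symmetric])
    then have k': "real k / 3 ^ n = real k' / 3 ^ m" by (simp add: k'_def)
    then have "k' \<le> height m" using m(1) by (simp add: reach_def divide_less_cancel)
    then have "emeasure \<nu> {0..<real k' / 3 ^ m} = of_nat k' * ennreal (w / 3 ^ m)"
      using emeasure_initial_interval[OF sets lev, of m k'] by simp
    also have "\<dots> = ennreal (w * (real k' / 3 ^ m))"
      using w(1) by (simp add: ennreal_of_nat_eq_real_of_nat ennreal_mult'[symmetric] mult.commute)
    finally show ?thesis using k' by simp
  qed
  \<comment> \<open>Lebesgue measure on the half-line times \<open>w\<close>, as a measure on all of the reals like \<open>\<nu>\<close>\<close>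
  let ?L = "density (lborel :: real measure) (\<lambda>x. ennreal w * indicator {0..} x)"
  have L: "emeasure ?L B = ennreal w * emeasure lborel ({0..} \<inter> B)" if "B \<in> sets borel" for B
  proof -
    have [measurable]: "B \<in> sets borel" by (rule that)
    have "emeasure ?L B = (\<integral>\<^sup>+x. ennreal w * indicator {0..} x * indicator B x \<partial>lborel)"
      using that by (intro emeasure_density) auto
    also have "\<dots> = (\<integral>\<^sup>+x. ennreal w * indicator ({0..} \<inter> B) x \<partial>lborel)"
      by (intro nn_integral_cong) (auto split: split_indicator)
    finally show ?thesis by (simp add: nn_integral_cmult_indicator)
  qed
  let ?E = "range (\<lambda>(k::int, n::nat). {..<real_of_int k / 3 ^ n})"
  have "\<nu> = ?L"
  proof (rule measure_eqI_generator_eq_countable[where \<Omega> = UNIV and E = ?E and A = "range (\<lambda>k::nat. {..<real k})"])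
    show "Int_stable ?E"
    proof (rule Int_stableI)
      fix a b assume "a \<in> ?E" "b \<in> ?E"
      then obtain k n l m where *: "a = {..<real_of_int k / 3 ^ n}" "b = {..<real_of_int l / 3 ^ m}" by auto
      have "a \<inter> b = a \<or> a \<inter> b = b" unfolding * by auto
      then show "a \<inter> b \<in> ?E" using \<open>a \<in> ?E\<close> \<open>b \<in> ?E\<close> by auto
    qed
    show "emeasure \<nu> X = emeasure ?L X" if "X \<in> ?E" for X
    proof -
      from that obtain kn where "X = (\<lambda>(k::int, n::nat). {..<real_of_int k / 3 ^ n}) kn" by blast
      then obtain k n where X: "X = {..<real_of_int k / 3 ^ n}" by (cases kn) auto
      show ?thesis
      proof (cases "k \<le> 0")
        case True
        then have "real_of_int k / 3 ^ n \<le> 0" by (simp add: divide_nonpos_pos)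
        then have "X \<subseteq> {..<0}" "{0..} \<inter> X = {}" unfolding X by auto
        then show ?thesis using emeasure_mono[of X "{..<0}" \<nu>] neg sets L[of X] by (simp add: X)
      next
        case False
        then have k: "real_of_int k / 3 ^ n = real (nat k) / 3 ^ n" by simp
        have pos: "0 \<le> real (nat k) / 3 ^ n" by simp
        have "X = {..<0} \<union> {0..<real (nat k) / 3 ^ n}" 
          unfolding X k by (rule ivl_disj_un_one(2)[OF pos, symmetric])
        then have "emeasure \<nu> X = emeasure \<nu> {..<0} + emeasure \<nu> {0..<real (nat k) / 3 ^ n}"
          by (auto simp: sets intro!: plus_emeasure[symmetric])
        moreover have "{0..} \<inter> X = {0..<real (nat k) / 3 ^ n}"
          unfolding X k by (rule set_eqI) (simp only: Int_iff atLeast_iff lessThan_iff atLeastLessThan_iff)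
        ultimately show ?thesis 
          using L[of X] neg init w(1) ennreal_mult'[of w "real (nat k) / 3 ^ n"] by (simp add: X)
      qed
    qed
    have "sets borel = sigma_sets UNIV ?E"
    proof -
      have "sets (borel :: real measure) = sigma_sets UNIV (range lessThan)"
        by (simp add: borel_Iio)
      also have "\<dots> = sigma_sets UNIV ?E"
      proof (rule sigma_sets_eqI)
        fix X :: "real set" assume "X \<in> range lessThan"
        then obtain a where X: "X = {..<a}" by auto
        have "\<exists>n. x < real_of_int \<lfloor>a * 3 ^ n\<rfloor> / 3 ^ n" if "x < a" for x
        proof -
          from that obtain n where n: "(1 / 3) ^ n < a - x"
            using real_arch_pow_inv[of "a - x" "1 / 3"] by auto
          have "a - (1 / 3) ^ n = (a * 3 ^ n - 1) / 3 ^ n" by (simp add: field_simps)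
          also have "\<dots> \<le> real_of_int \<lfloor>a * 3 ^ n\<rfloor> / 3 ^ n" by (rule divide_right_mono) (linarith, simp)
          finally show ?thesis using n by (intro exI[of _ n]) linarith
        qed
        moreover have "real_of_int \<lfloor>a * 3 ^ n\<rfloor> / 3 ^ n \<le> a" for n
          by (simp add: divide_le_eq)
        ultimately have "{..<a} = (\<Union>n. {..<real_of_int \<lfloor>a * 3 ^ n\<rfloor> / 3 ^ n})"
          by (auto intro: less_le_trans)
        moreover have "{..<real_of_int \<lfloor>a * 3 ^ n\<rfloor> / 3 ^ n} \<in> sigma_sets UNIV ?E" for n
          by (rule sigma_sets.Basic, rule range_eqI[of _ _ "(\<lfloor>a * 3 ^ n\<rfloor>, n)"]) simp
        ultimately show "X \<in> sigma_sets UNIV ?E"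
          unfolding X by (simp only: sigma_sets.Union)
      qed auto
      finally show ?thesis .
    qed
    then show "sets \<nu> = sigma_sets UNIV ?E" "sets ?L = sigma_sets UNIV ?E" using sets by auto
    show "range (\<lambda>k::nat. {..<real k}) \<subseteq> ?E"
    proof clarify
      fix k :: nat
      show "{..<real k} \<in> ?E" by (rule range_eqI[of _ _ "(int k, 0)"]) simp
    qed
    show "\<Union> (range (\<lambda>k::nat. {..<real k})) = UNIV" by (auto intro: reals_Archimedean2)
    show "emeasure \<nu> a \<noteq> \<infinity>" if "a \<in> range (\<lambda>k::nat. {..<real k})" for a
    proof -
      from that obtain k :: nat where k: "a = {..<real k}" by auto
      have "emeasure \<nu> a \<le> emeasure \<nu> {..<0} + emeasure \<nu> {0..<real k / 3 ^ 0}"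
        unfolding k by (rule order_trans[OF emeasure_mono emeasure_subadditive]) (auto simp: sets)
      then show ?thesis using neg init[of k 0] by (auto simp: top_unique)
    qed
  qed auto
  then have "emeasure \<nu> A = ennreal w * emeasure lborel ({0..} \<inter> A)"
    using L A by (simp add: sets_mu_iff)
  moreover have "{0..} \<inter> A = A" using A by (auto simp: sets_mu_iff)
  ultimately show ?thesis using w A by (simp add: emeasure_mu sets_mu_iff)
qed

section \<open>Sums of extended nonnegative reals\<close>

lemma emeasure_UN_infsum:
  fixes F :: "int \<Rightarrow> 'a set"
  assumes "\<And>k. F k \<in> sets M" "disjoint_family F"
  shows "emeasure M (\<Union>k. F k) = (\<Sum>\<^sub>\<infinity>k. emeasure M (F k))"
proof -
  have surj: "range int_decode = UNIV" and bij: "bij_betw int_decode UNIV UNIV"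
    using bij_int_decode by (auto simp: bij_betw_def bij_def)
  have "disjoint_family (\<lambda>n. F (int_decode n))"
    using assms(2) unfolding disjoint_family_on_def by (simp add: int_decode_eq)
  then have "(\<Sum>n. emeasure M (F (int_decode n))) = emeasure M (\<Union>n. F (int_decode n))"
    using assms(1) by (intro suminf_emeasure) auto
  also have "(\<Union>n. F (int_decode n)) = (\<Union>k. F k)"
    using surj by (metis image_image)
  also have "(\<Sum>n. emeasure M (F (int_decode n))) = (\<Sum>\<^sub>\<infinity>n. emeasure M (F (int_decode n)))"
    by (intro sums_unique[symmetric] has_sum_imp_sums has_sum_infsum nonneg_summable_on_complete) simp
  also have "\<dots> = (\<Sum>\<^sub>\<infinity>k. emeasure M (F k))"
    by (rule infsum_reindex_bij_betw[OF bij])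
  finally show ?thesis by simp
qed

lemma has_sum_enn2real:
  fixes w :: "'a \<Rightarrow> ennreal"
  assumes "infsum w UNIV = ennreal r" "0 \<le> r"
  shows "((\<lambda>k. enn2real (w k)) has_sum r) UNIV" and "\<And>k. ennreal (enn2real (w k)) = w k"
proof -
  have le: "sum w F \<le> ennreal r" if "finite F" for F
    using SUP_upper[of F "{F. finite F \<and> F \<subseteq> UNIV}" "sum w"] nonneg_infsum_complete[of UNIV w] assms(1) that
    by simp
  show fin: "ennreal (enn2real (w k)) = w k" for k
    using le[of "{k}"] by (cases "w k") (auto simp: top_unique)
  let ?a = "\<lambda>k. enn2real (w k)"
  have sum: "ennreal (sum ?a F) = sum w F" for F
    by (simp add: sum_ennreal[symmetric] fin)
  have "sum ?a F \<le> r" if "finite F" for F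
    using le[OF that] assms(2) unfolding sum[symmetric] by simp
  then have summable: "?a summable_on UNIV"
    by (intro nonneg_bdd_above_summable_on bdd_aboveI2[where M = r]) auto
  have "ennreal (infsum ?a UNIV) = infsum w UNIV"
    by (subst infsum_nonneg_is_SUPREMUM_ennreal[OF summable]) (simp_all add: nonneg_infsum_complete sum)
  then have "infsum ?a UNIV = r" using assms by (simp add: infsum_nonneg)
  then show "(?a has_sum r) UNIV" using summable has_sum_infsum by metis
qed

section \<open>Joinings are carried by the graphs\<close>

locale chacon_joining =
  fixes \<alpha> :: real and m :: "(real \<times> real) measure"
  assumes \<alpha>_pos: "0 < \<alpha>"
    and joining: "joining mu chacon (scale_measure (ennreal \<alpha>) mu) chacon m"
begin

lemma sets_m: "sets m = sets (mu \<Otimes>\<^sub>M mu)"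
proof -
  have "sets m = sets (mu \<Otimes>\<^sub>M scale_measure (ennreal \<alpha>) mu)"
    using joining by (simp add: joining_def)
  also have "\<dots> = sets (mu \<Otimes>\<^sub>M mu)" by (rule sets_pair_measure_cong) simp_all
  finally show ?thesis .
qed

lemma space_m: "space m = {0..} \<times> {0..}"
  using sets_eq_imp_space_eq[OF sets_m] by (simp add: space_pair_measure)

lemma measurable_mu_borel: "id \<in> measurable mu borel"
  unfolding mu_def by (rule measurable_restrict_space1) simp

lemma measurable_fst_mu: "fst \<in> measurable m mu" and measurable_snd_mu: "snd \<in> measurable m mu"
  by (simp_all add: measurable_cong_sets[OF sets_m refl])

lemma measurable_fst_m [measurable]: "fst \<in> borel_measurable m"
  and measurable_snd_m [measurable]: "snd \<in> borel_measurable m"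
  using measurable_comp[OF measurable_fst_mu measurable_mu_borel]
    measurable_comp[OF measurable_snd_mu measurable_mu_borel] by simp_all

lemma emeasure_fst: "A \<in> sets mu \<Longrightarrow> emeasure m {p \<in> space m. fst p \<in> A} = emeasure mu A"
proof -
  assume A: "A \<in> sets mu"
  have "emeasure mu A = emeasure (distr m mu fst) A" using joining by (simp add: joining_def)
  also have "\<dots> = emeasure m (fst -` A \<inter> space m)" by (rule emeasure_distr[OF measurable_fst_mu A])
  also have "fst -` A \<inter> space m = {p \<in> space m. fst p \<in> A}" by auto
  finally show ?thesis by simp
qed

lemma emeasure_snd: "A \<in> sets mu \<Longrightarrow> emeasure m {p \<in> space m. snd p \<in> A} = ennreal \<alpha> * emeasure mu A"
proof -
  let ?N = "scale_measure (ennreal \<alpha>) mu"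
  assume A: "A \<in> sets mu"
  have "ennreal \<alpha> * emeasure mu A = emeasure (distr m ?N snd) A"
    using joining by (simp add: joining_def)
  also have "\<dots> = emeasure m (snd -` A \<inter> space m)"
    using measurable_snd_mu A by (intro emeasure_distr) (simp_all cong: measurable_cong_sets)
  also have "snd -` A \<inter> space m = {p \<in> space m. snd p \<in> A}" by auto
  finally show ?thesis by simp
qed

lemma funpow_preimage_sets:
  assumes "C \<in> sets m"
  shows "{p \<in> space m. ((chacon ^^ k) (fst p), (chacon ^^ k) (snd p)) \<in> C} \<in> sets m"
proof -
  have "(\<lambda>p. ((chacon ^^ k) (fst p), (chacon ^^ k) (snd p))) \<in> measurable m m"
    unfolding measurable_cong_sets[OF refl sets_m]
    by (intro measurable_Pair measurable_compose[OF measurable_fst_mu]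
        measurable_compose[OF measurable_snd_mu] measurable_chacon_funpow)
  from measurable_sets[OF this assms] show ?thesis
    by (auto simp: vimage_def Int_def conj_commute cong: conj_cong)
qed

lemma emeasure_funpow:
  assumes "C \<in> sets m"
  shows "emeasure m {p \<in> space m. ((chacon ^^ k) (fst p), (chacon ^^ k) (snd p)) \<in> C} = emeasure m C"
proof (induction k)
  case 0
  have "{p \<in> space m. p \<in> C} = C" using sets.sets_into_space[OF assms] by auto
  then show ?case by simp
next
  case (Suc k)
  let ?C = "{p \<in> space m. ((chacon ^^ k) (fst p), (chacon ^^ k) (snd p)) \<in> C}"
  have "?C \<in> sets m" by (rule funpow_preimage_sets[OF assms])
  moreover have "emeasure m (map_prod chacon chacon -` D \<inter> space m) = emeasure m D" if "D \<in> sets m" for D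
    using joining that by (simp add: joining_def)
  ultimately have "emeasure m ?C = emeasure m (map_prod chacon chacon -` ?C \<inter> space m)"
    by (simp only:)
  also have "map_prod chacon chacon -` ?C \<inter> space m =
      {p \<in> space m. ((chacon ^^ Suc k) (fst p), (chacon ^^ Suc k) (snd p)) \<in> C}"
  proof (rule set_eqI)
    fix p
    show "p \<in> map_prod chacon chacon -` ?C \<inter> space m \<longleftrightarrow>
        p \<in> {p \<in> space m. ((chacon ^^ Suc k) (fst p), (chacon ^^ Suc k) (snd p)) \<in> C}"
      by (cases p) (simp add: space_m funpow_Suc_right chacon_nonneg conj_ac del: funpow.simps cong: conj_cong)
  qed
  finally show ?case using Suc by simp
qed

text \<open>
  From here on \<open>f\<close> and \<open>g\<close> stand for the two coordinate maps, in either order. This covers both signs of a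
  mismatch, and both marginals, by one argument.
\<close>

lemma coordinate_measurable:
  "f = fst \<or> f = snd \<Longrightarrow> f \<in> borel_measurable m"
  by auto

lemma coordinate_finite:
  assumes "f = fst \<or> f = snd"
  shows "emeasure m {p \<in> space m. f p < c} < \<infinity>"
proof -
  have c: "{0..<c} \<in> sets mu" by (auto simp: sets_mu_iff)
  have "{p \<in> space m. f p < c} = {p \<in> space m. f p \<in> {0..<c}}" using assms by (auto simp: space_m)
  moreover have "emeasure mu {0..<c} < \<infinity>" by (cases "0 \<le> c") (simp_all add: emeasure_mu_initial)
  ultimately show ?thesis
    using assms emeasure_fst[OF c] emeasure_snd[OF c] by (auto simp: ennreal_mult_less_top)
qed

lemma emeasure_mismatch_le:
  assumes fg: "f = fst \<or> f = snd" "g = fst \<or> g = snd" and st: "s < t" "t < 3" and N: "N \<le> n"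
  shows "emeasure m {p \<in> space m. f p < reach N \<and> f p \<in> subcolumn n s \<and> g p \<in> subcolumn n t}
    \<le> emeasure m {p \<in> space m. f p < reach N \<and> reach n \<le> g p \<and> g p < reach (Suc n)}"
    (is "_ \<le> emeasure m ?C")
proof -
  note [measurable] = coordinate_measurable[OF fg(1)] coordinate_measurable[OF fg(2)]
  \<comment> \<open>the number of steps from subcolumn \<open>s\<close> to the third subcolumn\<close>
  define k where "k = offset n 2 - offset n s"
  have C: "?C \<in> sets m" by measurable
  let ?P = "\<lambda>p. ((chacon ^^ k) (fst p), (chacon ^^ k) (snd p))"
  note D = funpow_preimage_sets[OF C, of k]
  have f: "f (?P p) = (chacon ^^ k) (f p)" and g: "g (?P p) = (chacon ^^ k) (g p)" for p
    using fg by auto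
  have "{p \<in> space m. f p < reach N \<and> f p \<in> subcolumn n s \<and> g p \<in> subcolumn n t}
      \<subseteq> {p \<in> space m. ?P p \<in> ?C}"
    using mismatch_escapes[OF st _ _ N, folded k_def] chacon_funpow_nonneg
    unfolding mem_Collect_eq f g by (auto simp: space_m)
  then have "emeasure m {p \<in> space m. f p < reach N \<and> f p \<in> subcolumn n s \<and> g p \<in> subcolumn n t}
      \<le> emeasure m {p \<in> space m. ?P p \<in> ?C}"
    by (rule emeasure_mono[OF _ D])
  then show ?thesis unfolding emeasure_funpow[OF C] .
qed

text \<open>
  The mismatches at step \<open>n\<close> are dominated by the set of pairs whose second point enters the towers
  exactly at step \<open>n + 1\<close>. These sets are disjoint and inside a set of finite measure, so their measures are
  summable.
\<close>

lemma AE_eventually_no_mismatch_below: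
  assumes fg: "f = fst \<or> f = snd" "g = fst \<or> g = snd" and st: "s < t" "t < 3"
  shows "AE p in m. f p < reach N \<longrightarrow>
    eventually (\<lambda>n. \<not> (f p \<in> subcolumn n s \<and> g p \<in> subcolumn n t)) sequentially"
proof -
  note [measurable] = coordinate_measurable[OF fg(1)] coordinate_measurable[OF fg(2)]
  define A where "A n = {p \<in> space m. f p < reach N \<and> f p \<in> subcolumn (n + N) s \<and> g p \<in> subcolumn (n + N) t}" for n
  define C where "C n = {p \<in> space m. f p < reach N \<and> reach (n + N) \<le> g p \<and> g p < reach (Suc (n + N))}" for n
  have AC [measurable]: "A n \<in> sets m" "C n \<in> sets m" for n unfolding A_def C_def by measurable
  have le: "emeasure m (A n) \<le> emeasure m (C n)" for n
    unfolding A_def C_def by (rule emeasure_mismatch_le[OF fg st]) simp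
  have disj: "disjoint_family C"
  proof -
    have "C n \<inter> C l = {}" if "n < l" for n l
      using reach_mono[of "Suc (n + N)" "l + N"] that by (auto simp: C_def)
    then show ?thesis unfolding disjoint_family_on_def by (metis Int_commute linorder_neqE_nat)
  qed
  have fin: "emeasure m (\<Union>n. C n) < \<infinity>"
  proof -
    have "emeasure m (\<Union>n. C n) \<le> emeasure m {p \<in> space m. f p < reach N}"
      by (rule emeasure_mono) (auto simp: C_def)
    then show ?thesis using coordinate_finite[OF fg(1), of "reach N"] by (rule le_less_trans)
  qed
  have Cfin: "emeasure m (C n) < \<infinity>" for n
    using emeasure_mono[of "C n" "\<Union>n. C n" m] fin by (auto intro: le_less_trans)
  have "summable (\<lambda>n. measure m (C n))"
    by (rule sums_summable, rule measure_UNION[OF _ disj]) (use fin AC in auto)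
  note C_summable = this
  have A_le: "measure m (A n) \<le> measure m (C n)" for n
    unfolding measure_def using le[of n] Cfin[of n] by (intro enn2real_mono) auto
  have "summable (\<lambda>n. measure m (A n))"
    by (rule summable_comparison_test'[OF C_summable, of 0]) (use A_le in simp)
  moreover have "emeasure m (A n) < \<infinity>" for n using le[of n] Cfin[of n] by (rule le_less_trans)
  ultimately have "AE p in m. eventually (\<lambda>n. p \<in> space m - A n) sequentially"
    by (intro borel_cantelli_AE1 AC)
  then show ?thesis
  proof (rule AE_mp, intro AE_I2 impI)
    fix p assume p: "p \<in> space m" "eventually (\<lambda>n. p \<in> space m - A n) sequentially" "f p < reach N"
    from p(2) have "eventually (\<lambda>n. \<not> (f p \<in> subcolumn (n + N) s \<and> g p \<in> subcolumn (n + N) t)) sequentially"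
      by eventually_elim (use p in \<open>auto simp: A_def\<close>)
    then show "eventually (\<lambda>n. \<not> (f p \<in> subcolumn n s \<and> g p \<in> subcolumn n t)) sequentially"
      by (rule eventually_sequentially_seg[THEN iffD1])
  qed
qed

lemma AE_eventually_no_mismatch:
  assumes fg: "f = fst \<or> f = snd" "g = fst \<or> g = snd" and st: "s < t" "t < 3"
  shows "AE p in m. eventually (\<lambda>n. \<not> (f p \<in> subcolumn n s \<and> g p \<in> subcolumn n t)) sequentially"
proof -
  have "AE p in m. \<forall>N. f p < reach N \<longrightarrow>
      eventually (\<lambda>n. \<not> (f p \<in> subcolumn n s \<and> g p \<in> subcolumn n t)) sequentially"
    unfolding AE_all_countable using AE_eventually_no_mismatch_below[OF assms] by blast
  then show ?thesis
  proof (rule AE_mp, intro AE_I2 impI)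
    fix p assume "\<forall>N. f p < reach N \<longrightarrow>
      eventually (\<lambda>n. \<not> (f p \<in> subcolumn n s \<and> g p \<in> subcolumn n t)) sequentially"
    moreover obtain N where "f p < reach N" by (rule less_reach)
    ultimately show "eventually (\<lambda>n. \<not> (f p \<in> subcolumn n s \<and> g p \<in> subcolumn n t)) sequentially"
      by blast
  qed
qed

lemma AE_shifted: "AE p in m. \<exists>k. shifted k (fst p) (snd p)"
proof -
  have "AE p in m. \<forall>s t. s < t \<and> t < 3 \<longrightarrow>
      eventually (\<lambda>n. \<not> (fst p \<in> subcolumn n s \<and> snd p \<in> subcolumn n t)) sequentially \<and>
      eventually (\<lambda>n. \<not> (snd p \<in> subcolumn n s \<and> fst p \<in> subcolumn n t)) sequentially"
    unfolding AE_all_countable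
    using AE_eventually_no_mismatch[of fst snd] AE_eventually_no_mismatch[of snd fst] by auto
  then show ?thesis
  proof (rule AE_mp, intro AE_I2 impI)
    fix p assume p: "p \<in> space m" and *: "\<forall>s t. s < t \<and> t < 3 \<longrightarrow>
      eventually (\<lambda>n. \<not> (fst p \<in> subcolumn n s \<and> snd p \<in> subcolumn n t)) sequentially \<and>
      eventually (\<lambda>n. \<not> (snd p \<in> subcolumn n s \<and> fst p \<in> subcolumn n t)) sequentially"
    have "eventually (\<lambda>n. \<forall>(s, t) \<in> {(s, t). s < t \<and> t < 3}.
        \<not> (fst p \<in> subcolumn n s \<and> snd p \<in> subcolumn n t) \<and>
        \<not> (snd p \<in> subcolumn n s \<and> fst p \<in> subcolumn n t)) sequentially"
    proof (rule eventually_ball_finite)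
      show "finite {(s::nat, t::nat). s < t \<and> t < 3}"
        by (rule finite_subset[of _ "{..<3} \<times> {..<3}"]) auto
    qed (use * in \<open>auto intro: eventually_conj\<close>)
    then have "eventually (\<lambda>n. \<forall>s<3. \<forall>t<3. fst p \<in> subcolumn n s \<longrightarrow> snd p \<in> subcolumn n t \<longrightarrow> s = t) sequentially"
      by (rule eventually_mono) (metis (mono_tags, lifting) case_prodI linorder_neqE_nat mem_Collect_eq case_prodD)
    then show "\<exists>k. shifted k (fst p) (snd p)"
      using p by (intro eventually_matched_imp_shifted) (auto simp: space_m)
  qed
qed

section \<open>The joining on a single graph\<close>

definition graph :: "int \<Rightarrow> (real \<times> real) set" where
  "graph k = {p \<in> space m. shifted k (fst p) (snd p)}"

lemma graph_sets [measurable]: "graph k \<in> sets m"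
proof -
  let ?B = "\<lambda>n i j. {p \<in> space m. fst p \<in> level n i \<and> snd p = tower n ! j + (fst p - tower n ! i)}"
  have "graph k = (\<Union>n. \<Union>i\<in>{..<height n}. \<Union>j\<in>{j. j < height n \<and> int j = int i + k}. ?B n i j)"
    (is "_ = ?U")
  proof (intro set_eqI iffI)
    fix p assume p: "p \<in> graph k"
    then obtain n i j r where c: "coord n i r (fst p)" "coord n j r (snd p)" "int j = int i + k"
      unfolding shifted_def graph_def by blast
    then have "p \<in> ?B n i j" "i < height n" "j < height n"
      using p by (auto simp: coord_def level_def graph_def)
    with c(3) show "p \<in> ?U" by blast
  next
    fix p assume "p \<in> ?U"
    then obtain n i j where c: "i < height n" "j < height n" "int j = int i + k" "p \<in> ?B n i j" by blast
    then have "coord n i (fst p - tower n ! i) (fst p)" "coord n j (fst p - tower n ! i) (snd p)"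
      by (auto simp: coord_def level_def)
    then have "shifted k (fst p) (snd p)" using c(3) unfolding shifted_def by blast
    with c(4) show "p \<in> graph k" by (simp add: graph_def)
  qed
  moreover have "?U \<in> sets m" unfolding level_def by measurable
  ultimately show ?thesis by simp
qed

lemma emeasure_graph_decomposition:
  assumes C [measurable]: "C \<in> sets m"
  shows "emeasure m C = (\<Sum>\<^sub>\<infinity>k. emeasure m (C \<inter> graph k))"
proof -
  have "emeasure m C = emeasure m (\<Union>k. C \<inter> graph k)"
  proof (rule emeasure_eq_AE)
    show "AE p in m. p \<in> C \<longleftrightarrow> p \<in> (\<Union>k. C \<inter> graph k)"
      using AE_shifted by (rule AE_mp) (auto simp: graph_def)
  qed measurable
  also have "\<dots> = (\<Sum>\<^sub>\<infinity>k. emeasure m (C \<inter> graph k))"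
    using shifted_index_unique
    by (intro emeasure_UN_infsum sets.Int C graph_sets) (auto simp: disjoint_family_on_def graph_def)
  finally show ?thesis .
qed

lemma shifted_chacon_iff:
  assumes "0 \<le> x" "0 \<le> y"
  shows "shifted k (chacon x) (chacon y) \<longleftrightarrow> shifted k x y"
proof
  assume "shifted k (chacon x) (chacon y)"
  then have "shifted (1 + k + - 1) x y"
    using shifted_trans shifted_chacon[OF assms(1)] shifted_minus[OF shifted_chacon[OF assms(2)]] by blast
  then show "shifted k x y" by simp
next
  assume "shifted k x y"
  then have "shifted (- 1 + k + 1) (chacon x) (chacon y)"
    using shifted_trans shifted_chacon[OF assms(2)] shifted_minus[OF shifted_chacon[OF assms(1)]] by blast
  then show "shifted k (chacon x) (chacon y)" by simp
qed

lemma chacon_mem_level_iff: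
  assumes "0 \<le> x" "Suc i < height n"
  shows "chacon x \<in> level n (Suc i) \<longleftrightarrow> x \<in> level n i"
proof -
  have "(\<exists>r. coord n (Suc i) r (chacon x)) \<longleftrightarrow> (\<exists>r. coord n i r x)"
    using shifted_coord[OF shifted_chacon[OF assms(1)], of n i _ "Suc i"] assms(2)
      shifted_coord[OF shifted_minus[OF shifted_chacon[OF assms(1)]], of n "Suc i" _ i] by auto
  then show ?thesis using assms(2) by (simp add: mem_level_iff)
qed

text \<open>
  For \<open>f = fst\<close> these are the coefficients of the convex combination; \<open>f = snd\<close> turns out to give the same
  numbers.
\<close>

definition weight :: "(real \<times> real \<Rightarrow> real) \<Rightarrow> int \<Rightarrow> ennreal" where
  "weight f k = emeasure m {p \<in> graph k. f p \<in> {0..<1}}"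

text \<open>
  The mass of the graph above a level does not change from a level to the next one: both coordinates of a
  point of the graph move up together, and the graph is its own preimage.
\<close>

lemma emeasure_graph_coordinate:
  assumes f: "f = fst \<or> f = snd" and A: "A \<in> sets mu"
  shows "emeasure m {p \<in> graph k. f p \<in> A} = weight f k * emeasure mu A"
proof -
  note [measurable] = coordinate_measurable[OF f]
  have graph: "graph k \<subseteq> space m" by (auto simp: graph_def)
  define \<nu> where "\<nu> = distr (density m (indicator (graph k))) borel f"
  have \<nu>: "emeasure \<nu> B = emeasure m {p \<in> graph k. f p \<in> B}" if [measurable]: "B \<in> sets borel" for B
  proof -
    have "emeasure \<nu> B = emeasure (density m (indicator (graph k))) (f -` B \<inter> space m)"
      unfolding \<nu>_def by (subst emeasure_distr) auto
    also have "\<dots> = (\<integral>\<^sup>+p. indicator (graph k) p * indicator (f -` B \<inter> space m) p \<partial>m)"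
      by (rule emeasure_density) measurable
    also have "\<dots> = (\<integral>\<^sup>+p. indicator {p \<in> graph k. f p \<in> B} p \<partial>m)"
      using graph by (intro nn_integral_cong) (auto split: split_indicator)
    also have "\<dots> = emeasure m {p \<in> graph k. f p \<in> B}"
    proof (rule nn_integral_indicator)
      have "{p \<in> graph k. f p \<in> B} = graph k \<inter> {p \<in> space m. f p \<in> B}" using graph by auto
      also have "\<dots> \<in> sets m" by measurable
      finally show "{p \<in> graph k. f p \<in> B} \<in> sets m" .
    qed
    finally show ?thesis .
  qed
  have lev: "level n i \<in> sets borel" for n i by (simp add: level_def)
  have step: "emeasure \<nu> (level n (Suc i)) = emeasure \<nu> (level n i)" if i: "Suc i < height n" for n i
  proof -
    have C: "{p \<in> graph k. f p \<in> level n (Suc i)} \<in> sets m"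
    proof -
      have "{p \<in> graph k. f p \<in> level n (Suc i)} = graph k \<inter> {p \<in> space m. f p \<in> level n (Suc i)}"
        using graph by auto
      also have "\<dots> \<in> sets m" unfolding level_def by measurable
      finally show ?thesis .
    qed
    have "{p \<in> space m. ((chacon ^^ 1) (fst p), (chacon ^^ 1) (snd p)) \<in> {p \<in> graph k. f p \<in> level n (Suc i)}}
        = {p \<in> graph k. f p \<in> level n i}"
    proof (rule set_eqI)
      fix p
      show "p \<in> {p \<in> space m. ((chacon ^^ 1) (fst p), (chacon ^^ 1) (snd p)) \<in> {p \<in> graph k. f p \<in> level n (Suc i)}}
          \<longleftrightarrow> p \<in> {p \<in> graph k. f p \<in> level n i}"
      proof (cases "p \<in> space m")
        case True
        then have p: "0 \<le> fst p" "0 \<le> snd p" by (auto simp: space_m)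
        have "f (chacon (fst p), chacon (snd p)) = chacon (f p)" "0 \<le> f p" using f p by auto
        with p True show ?thesis
          by (simp add: graph_def space_m shifted_chacon_iff chacon_mem_level_iff[OF _ i] chacon_nonneg)
      qed (simp add: graph_def)
    qed
    then show ?thesis using emeasure_funpow[OF C, of 1] by (simp add: \<nu> lev)
  qed
  have const: "emeasure \<nu> (level n i) = emeasure \<nu> (level n 0)" if "i < height n" for n i
    using that by (induction i) (simp_all add: step)
  have neg: "emeasure \<nu> {..<0} = 0"
  proof -
    have "{p \<in> graph k. f p \<in> {..<0}} = {}" using f by (auto simp: graph_def space_m)
    then show ?thesis by (simp only: \<nu> sets_lborel lessThan_borel emeasure_empty)
  qed
  have "emeasure m {p \<in> graph k. f p \<in> {0..<1}} \<le> emeasure m {p \<in> space m. f p < 1}"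
    using graph by (intro emeasure_mono) auto
  then have "emeasure \<nu> {0..<1} < \<infinity>"
    using coordinate_finite[OF f, of 1] by (simp add: \<nu> del: atLeastLessThan_iff)
  from level_constant_measure[OF _ neg const this A] A show ?thesis
    by (simp add: \<nu>_def[THEN arg_cong[where f = sets]] \<nu> sets_mu_iff weight_def del: atLeastLessThan_iff)
qed

text \<open>
  In a tower of height greater than \<open>\<bar>k\<bar>\<close> there are levels \<open>i\<close> and \<open>j = i + k\<close>, and the graph pairs
  the points of level \<open>i\<close> exactly with those of level \<open>j\<close>.
\<close>

lemma weight_fst_eq_snd: "weight fst k = weight snd k"
proof -
  define n where "n = nat \<bar>k\<bar>"
  define i where "i = nat (- k)"
  define j where "j = nat k"
  have "n < height n" for n by (induction n) (simp_all add: height_Suc)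
  then have ij: "i < height n" "j < height n" "int j = int i + k" "int i = int j + - k"
    using order_le_less_trans[of i n "height n"] order_le_less_trans[of j n "height n"]
    by (auto simp: i_def j_def n_def)
  have mu: "level n i \<in> sets mu" "level n j \<in> sets mu"
    using ij level_sets_mu by auto
  have eq: "{p \<in> graph k. fst p \<in> level n i} = {p \<in> graph k. snd p \<in> level n j}"
  proof (rule Collect_cong, rule conj_cong)
    fix p assume "p \<in> graph k"
    then have "shifted k (fst p) (snd p)" by (simp add: graph_def)
    then have "coord n i r (fst p) \<longleftrightarrow> coord n j r (snd p)" for r
      using shifted_coord[OF _ _ ij(3,2)] shifted_coord[OF shifted_minus _ ij(4,1)] by blast
    then show "fst p \<in> level n i \<longleftrightarrow> snd p \<in> level n j" using ij by (simp add: mem_level_iff)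
  qed simp
  have "weight fst k * emeasure mu (level n i) = weight snd k * emeasure mu (level n j)"
    unfolding emeasure_graph_coordinate[of fst, OF disjI1[OF refl] mu(1), symmetric]
      emeasure_graph_coordinate[of snd, OF disjI2[OF refl] mu(2), symmetric] eq ..
  then have "weight fst k * ennreal (1 / 3 ^ n) = weight snd k * ennreal (1 / 3 ^ n)"
    using ij by (simp add: emeasure_mu_level)
  then show ?thesis by (simp add: mult.commute[of _ "ennreal _"] ennreal_mult_cancel_left)
qed

lemma infsum_weight: "(\<Sum>\<^sub>\<infinity>k. weight fst k) = 1" and \<alpha>_eq_1: "\<alpha> = 1"
proof -
  have I: "{0..<1::real} \<in> sets mu" by (auto simp: sets_mu_iff)
  have mu: "emeasure mu {0..<1} = 1" by (simp add: emeasure_mu_initial)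
  have *: "emeasure m {p \<in> space m. f p \<in> {0..<1}} = (\<Sum>\<^sub>\<infinity>k. weight f k)" if f: "f = fst \<or> f = snd" for f
  proof -
    note [measurable] = coordinate_measurable[OF f]
    have "{p \<in> space m. f p \<in> {0..<1}} \<inter> graph k = {p \<in> graph k. f p \<in> {0..<1}}" for k
      by (auto simp: graph_def)
    then show ?thesis by (subst emeasure_graph_decomposition) (simp_all add: weight_def[abs_def] del: atLeastLessThan_iff)
  qed
  show "(\<Sum>\<^sub>\<infinity>k. weight fst k) = 1" using *[of fst] emeasure_fst[OF I] mu by simp
  moreover have "(\<Sum>\<^sub>\<infinity>k. weight fst k) = ennreal \<alpha>"
    using *[of snd] emeasure_snd[OF I] mu by (simp add: weight_fst_eq_snd)
  ultimately show "\<alpha> = 1" by (simp add: ennreal_eq_1)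
qed

lemma emeasure_rectangle:
  assumes A: "A1 \<in> sets mu" "A2 \<in> sets mu"
  shows "emeasure m (A1 \<times> A2) = (\<Sum>\<^sub>\<infinity>k. weight fst k * emeasure mu (A1 \<inter> chacon_preimage k A2))"
proof -
  have "A1 \<times> A2 \<in> sets m" using A by (simp add: sets_m)
  then have "emeasure m (A1 \<times> A2) = (\<Sum>\<^sub>\<infinity>k. emeasure m (A1 \<times> A2 \<inter> graph k))"
    by (rule emeasure_graph_decomposition)
  also have "\<dots> = (\<Sum>\<^sub>\<infinity>k. weight fst k * emeasure mu (A1 \<inter> chacon_preimage k A2))"
  proof (rule infsum_cong)
    fix k
    have "A1 \<times> A2 \<inter> graph k = {p \<in> graph k. fst p \<in> A1 \<inter> chacon_preimage k A2}"
    proof (rule set_eqI)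
      fix p :: "real \<times> real"
      have "shifted k (fst p) (snd p) \<Longrightarrow> snd p \<in> A2 \<longleftrightarrow> (\<exists>y\<in>A2. shifted k (fst p) y)"
        using shifted_target_unique by blast
      then show "p \<in> A1 \<times> A2 \<inter> graph k \<longleftrightarrow> p \<in> {p \<in> graph k. fst p \<in> A1 \<inter> chacon_preimage k A2}"
        using A(2) by (auto simp: sets_mu_iff chacon_preimage_eq graph_def mem_Times_iff)
    qed
    moreover have "A1 \<inter> chacon_preimage k A2 \<in> sets mu"
      using A chacon_preimage_sets_mu by (intro sets.Int)
    ultimately show "emeasure m (A1 \<times> A2 \<inter> graph k) = weight fst k * emeasure mu (A1 \<inter> chacon_preimage k A2)"
      using emeasure_graph_coordinate[of fst "A1 \<inter> chacon_preimage k A2" k] by (simp only: simp_thms)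
  qed
  finally show ?thesis .
qed

end

theorem proposition4p1:
  fixes \<alpha> :: real and m :: "(real \<times> real) measure"
  assumes "\<alpha> > 0"
    and "joining mu chacon (scale_measure (ennreal \<alpha>) mu) chacon m"
  shows "\<alpha> = 1 \<and>
    (\<exists>a :: int \<Rightarrow> real. (\<forall>k. 0 \<le> a k) \<and> (a has_sum 1) UNIV \<and>
      (\<forall>A1 \<in> sets mu. \<forall>A2 \<in> sets mu.
        emeasure m (A1 \<times> A2) =
          (\<Sum>\<^sub>\<infinity>k. ennreal (a k) * emeasure mu (A1 \<inter> chacon_preimage k A2))))"
proof -
  interpret chacon_joining \<alpha> m using assms by unfold_locales
  note w = has_sum_enn2real[of "weight fst" 1]
  show ?thesis
    using \<alpha>_eq_1 infsum_weight w emeasure_rectangle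
    by (intro conjI exI[of _ "\<lambda>k. enn2real (weight fst k)"]) simp_all
qed

end
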